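(* Let $m<n$ and $k$ be positive integers, let $X\in\mathbb{R}^{m\times n}$ have rank $r$ and singular values $\sigma_1\ge\dots\ge\sigma_r>0=\sigma_{r+1}=\dots=\sigma_m$, and let $J(W,S)=\tfrac12\|X-WS\|_F^2$ on $\mathbb{R}^{m\times k}\times\mathbb{R}^{k\times n}$. Let $1\le q\le\min\{k,r\}$ and let $(W_0,S_0)$ be a balanced canonical point of rank $q$ with selected positive singular values $\lambda_1\ge\dots\ge\lambda_q>0$ (it is a critical point of $J$ lying in $\mathcal{M}_0$). If $(W_0,S_0)$ is not maximal, let $p\in\{1,\dots,q\}$ be the least integer with $\lambda_p<\sigma_p$. (a) If $q=\min\{k,r\}$ and $(W_0,S_0)$ is maximal, then it is a global minimum of $J$. (b) If $q=\min\{k,r\}$ and $(W_0,S_0)$ is not maximal, then $\lambda_{\min}(\nabla^2J(W_0,S_0))=-(\sigma_p-\lambda_k)$. (c) If $q<\min\{k,r\}$, then $\lambda_{\min}(\nabla^2J(W_0,S_0))=-\sigma_{q+1}$ if $(W_0,S_0)$ is maximal, and $\lambda_{\min}(\nabla^2J(W_0,S_0))=-\sigma_p$ if $(W_0,S_0)$ is not maximal.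
   Context: $\mathbb{R}^{m\times k}\times\mathbb{R}^{k\times n}$ carries the inner product $\langle (G,H),(G',H')\rangle=\mathrm{trace}(G^TG')+\mathrm{trace}(H^TH')$. With $E=WS-X$, $\nabla J(W,S)=(ES^T,W^TE)$ and the Hessian map is the self-adjoint linear map $\nabla^2J(W,S)[(G,H)]=(GSS^T+WHS^T+EH^T,\ W^TWH+W^TGS+G^TE)$; $\lambda_{\min}$ is its smallest eigenvalue. $\mathcal{M}_0=\{(W,S):W^TW=SS^T\}$. Balanced canonical points. Take a full SVD of $X$, i.e. orthonormal bases $u_1,\dots,u_m$ of $\mathbb{R}^m$ and $v_1,\dots,v_n$ of $\mathbb{R}^n$ with $Xv_i=\sigma_iu_i$, $X^Tu_i=\sigma_iv_i$ for $i\le m$ and $Xv_i=0$ for $i>m$. Choose $q$ distinct indices $i_1,\dots,i_q\in\{1,\dots,r\}$ ordered so that $\lambda_j:=\sigma_{i_j}$ satisfies $\lambda_1\ge\dots\ge\lambda_q>0$. Put $\bar U=[u_{i_1},\dots,u_{i_q}]$, $\bar V=[v_{i_1},\dots,v_{i_q}]$, $\Lambda=\mathrm{diag}(\lambda_1,\dots,\lambda_q)$. The balanced canonical point of rank $q$ is $$(W_0,S_0)=\left(\begin{bmatrix}\bar U\Lambda^{1/2} & 0_{m\times(k-q)}\end{bmatrix},\ \begin{bmatrix}\Lambda^{1/2}\bar V^T\\ 0_{(k-q)\times n}\end{bmatrix}\right).$$ It is maximal if $\lambda_j=\sigma_j$ for all $j=1,\dots,q$. *)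

theory Defs
  imports "HOL-Analysis.Analysis"
begin

section \<open>Gradient, Hessian, smallest eigenvalue\<close>

definition gradient :: "('a::real_inner \<Rightarrow> real) \<Rightarrow> 'a \<Rightarrow> 'a" where
  "gradient f x = (THE D. GDERIV f x :> D)"

definition hessian :: "('a::real_inner \<Rightarrow> real) \<Rightarrow> 'a \<Rightarrow> 'a \<Rightarrow> 'a" where
  "hessian f x = frechet_derivative (gradient f) (at x)"

definition is_eigenvalue :: "('a::real_vector \<Rightarrow> 'a) \<Rightarrow> real \<Rightarrow> bool" where
  "is_eigenvalue T \<mu> \<longleftrightarrow> (\<exists>x. x \<noteq> 0 \<and> T x = \<mu> *\<^sub>R x)"

text \<open>\<open>LEAST\<close> at type \<open>real\<close> is meaningful only if a smallest eigenvalue exists, as it does for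
  self-adjoint maps of nontrivial finite-dimensional spaces.\<close>

definition lambda_min :: "('a::real_vector \<Rightarrow> 'a) \<Rightarrow> real" where
  "lambda_min T = (LEAST \<mu>. is_eigenvalue T \<mu>)"


section \<open>The factorization objective\<close>

text \<open>On \<open>real^'n^'m\<close>, \<open>norm\<close> is the Frobenius norm, and the inner product of a product of such spaces
  is the sum of the two trace inner products (lemma \<open>inner_matrix_pair\<close> below).\<close>

definition J :: "real^'n^'m \<Rightarrow> (real^'k^'m) \<times> (real^'n^'k) \<Rightarrow> real" where
  "J X = (\<lambda>(W, S). (norm (X - W ** S))\<^sup>2 / 2)"

definition M0 :: "((real^'k^'m) \<times> (real^'n^'k)) set" where
  "M0 = {(W, S). transpose W ** W = S ** transpose S}"


section \<open>Balanced canonical points\<close>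

definition is_orthonormal_basis :: "(nat \<Rightarrow> 'a::euclidean_space) \<Rightarrow> bool" where
  "is_orthonormal_basis b \<longleftrightarrow>
     (\<forall>i\<in>{1..DIM('a)}. \<forall>j\<in>{1..DIM('a)}. b i \<bullet> b j = (if i = j then 1 else 0)) \<and>
     span (b ` {1..DIM('a)}) = UNIV"

definition is_full_svd ::
  "real^'n^'m \<Rightarrow> (nat \<Rightarrow> real) \<Rightarrow> (nat \<Rightarrow> real^'m) \<Rightarrow> (nat \<Rightarrow> real^'n) \<Rightarrow> bool" where
  "is_full_svd X \<sigma> u v \<longleftrightarrow>
     is_orthonormal_basis u \<and> is_orthonormal_basis v \<and>
     (\<forall>i\<in>{1..CARD('m)}. 0 \<le> \<sigma> i) \<and>
     (\<forall>i\<in>{1..CARD('m)}. \<forall>j\<in>{1..CARD('m)}. i \<le> j \<longrightarrow> \<sigma> j \<le> \<sigma> i) \<and>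
     (\<forall>i\<in>{1..CARD('m)}. X *v v i = \<sigma> i *\<^sub>R u i \<and> transpose X *v u i = \<sigma> i *\<^sub>R v i) \<and>
     (\<forall>i\<in>{CARD('m)<..CARD('n)}. X *v v i = 0)"

text \<open>\<open>idx j\<close> is the index usually written \<open>i_j\<close>.\<close>

definition is_selection ::
  "(nat \<Rightarrow> real) \<Rightarrow> nat \<Rightarrow> nat \<Rightarrow> (nat \<Rightarrow> nat) \<Rightarrow> (nat \<Rightarrow> real) \<Rightarrow> bool" where
  "is_selection \<sigma> r q idx lam \<longleftrightarrow>
     inj_on idx {1..q} \<and> idx ` {1..q} \<subseteq> {1..r} \<and>
     (\<forall>j\<in>{1..q}. lam j = \<sigma> (idx j) \<and> lam j > 0) \<and>
     (\<forall>i\<in>{1..q}. \<forall>j\<in>{1..q}. i \<le> j \<longrightarrow> lam j \<le> lam i)"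

text \<open>\<open>col\<close> numbers the index type \<open>'k\<close> (columns of \<open>W\<close>, rows of \<open>S\<close>) by \<open>1, \<dots>, CARD('k)\<close>. Column
  number \<open>j\<close> of the first matrix is \<open>sqrt (lam j) *\<^sub>R u (idx j)\<close> if \<open>j \<le> q\<close> and zero otherwise;
  similarly for the rows of the second.\<close>

definition canonical_point ::
  "('k \<Rightarrow> nat) \<Rightarrow> (nat \<Rightarrow> real^'m) \<Rightarrow> (nat \<Rightarrow> real^'n) \<Rightarrow> nat \<Rightarrow> (nat \<Rightarrow> nat) \<Rightarrow> (nat \<Rightarrow> real)
     \<Rightarrow> (real^'k^'m) \<times> (real^'n^'k)" where
  "canonical_point col u v q idx lam =
     ((\<chi> a c. if col c \<le> q then u (idx (col c)) $ a * sqrt (lam (col c)) else 0),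
      (\<chi> c b. if col c \<le> q then sqrt (lam (col c)) * v (idx (col c)) $ b else 0))"

definition is_balanced_canonical_point ::
  "('k \<Rightarrow> nat) \<Rightarrow> real^'n^'m \<Rightarrow> (nat \<Rightarrow> real) \<Rightarrow> nat \<Rightarrow> nat \<Rightarrow> (nat \<Rightarrow> real)
     \<Rightarrow> (real^'k^'m) \<times> (real^'n^'k) \<Rightarrow> bool" where
  "is_balanced_canonical_point col X \<sigma> r q lam P \<longleftrightarrow>
     (\<exists>u v idx. is_full_svd X \<sigma> u v \<and> is_selection \<sigma> r q idx lam \<and>
                P = canonical_point col u v q idx lam)"

definition is_maximal :: "(nat \<Rightarrow> real) \<Rightarrow> nat \<Rightarrow> (nat \<Rightarrow> real) \<Rightarrow> bool" where
  "is_maximal \<sigma> q lam \<longleftrightarrow> (\<forall>j\<in>{1..q}. lam j = \<sigma> j)"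

text \<open>Meaningful only at non-maximal points: there \<open>lam j \<noteq> \<sigma> j\<close> for some \<open>j\<close>, and \<open>lam j \<le> \<sigma> j\<close>
  always, since \<open>lam\<close> is a sorted selection.\<close>

definition first_gap :: "(nat \<Rightarrow> real) \<Rightarrow> nat \<Rightarrow> (nat \<Rightarrow> real) \<Rightarrow> nat" where
  "first_gap \<sigma> q lam = (LEAST p. p \<in> {1..q} \<and> lam p < \<sigma> p)"


section \<open>The explicit formulas for inner product, gradient and Hessian\<close>

lemma inner_matrix_trace:
  fixes A B :: "real^'n^'m"
  shows "A \<bullet> B = trace (transpose A ** B)"
  unfolding inner_vec_def trace_def matrix_matrix_mult_def transpose_def
  by (simp add: sum.swap[of _ "UNIV :: 'm set"])

lemma inner_matrix_pair:
  fixes G G' :: "real^'k^'m" and H H' :: "real^'n^'k"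
  shows "(G, H) \<bullet> (G', H') = trace (transpose G ** G') + trace (transpose H ** H')"
  by (simp add: inner_matrix_trace)

lemma mat_add_rdistrib:
  fixes A B :: "real^'k^'m" and C :: "real^'n^'k"
  shows "(A + B) ** C = A ** C + B ** C"
  by (simp add: vec_eq_iff matrix_matrix_mult_def sum.distrib algebra_simps)

lemma bounded_bilinear_matrix_mult:
  "bounded_bilinear ((**) :: real^'k^'m \<Rightarrow> real^'n^'k \<Rightarrow> real^'n^'m)"
proof -
  have "bilinear ((**) :: real^'k^'m \<Rightarrow> real^'n^'k \<Rightarrow> real^'n^'m)"
    unfolding bilinear_def
    by (auto intro!: linearI simp: vec_eq_iff matrix_matrix_mult_def
        sum.distrib sum_distrib_left algebra_simps)
  then show ?thesis by (simp add: bilinear_conv_bounded_bilinear)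
qed

lemma inner_matrix_mult_left:
  fixes G :: "real^'k^'m" and S :: "real^'n^'k" and E :: "real^'n^'m"
  shows "(G ** S) \<bullet> E = G \<bullet> (E ** transpose S)"
proof -
  have "(G ** S) \<bullet> E = (\<Sum>i\<in>UNIV. \<Sum>j\<in>UNIV. \<Sum>c\<in>UNIV. G$i$c * S$c$j * E$i$j)"
    by (simp add: inner_vec_def matrix_matrix_mult_def sum_distrib_right)
  also have "\<dots> = (\<Sum>i\<in>UNIV. \<Sum>c\<in>UNIV. \<Sum>j\<in>UNIV. G$i$c * S$c$j * E$i$j)"
    by (intro sum.cong refl sum.swap)
  also have "\<dots> = G \<bullet> (E ** transpose S)"
    by (simp add: inner_vec_def matrix_matrix_mult_def transpose_def sum_distrib_left mult_ac)
  finally show ?thesis .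
qed

lemma inner_transpose:
  fixes A B :: "real^'n^'m"
  shows "transpose A \<bullet> transpose B = A \<bullet> B"
  by (simp add: inner_vec_def transpose_def sum.swap[of _ "UNIV :: 'm set"])

lemma inner_matrix_mult_right:
  fixes W :: "real^'k^'m" and H :: "real^'n^'k" and E :: "real^'n^'m"
  shows "(W ** H) \<bullet> E = H \<bullet> (transpose W ** E)"
proof -
  have "(W ** H) \<bullet> E = (transpose H ** transpose W) \<bullet> transpose E"
    by (metis inner_transpose matrix_transpose_mul)
  also have "\<dots> = transpose H \<bullet> transpose (transpose W ** E)"
    by (simp add: inner_matrix_mult_left matrix_transpose_mul)
  finally show ?thesis by (simp add: inner_transpose)
qed

lemma transpose_has_derivative:
  "(transpose has_derivative transpose) (at (A :: real^'n^'m))"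
proof -
  have "linear (transpose :: real^'n^'m \<Rightarrow> real^'m^'n)"
    by (auto intro!: linearI simp: transpose_def vec_eq_iff)
  then show ?thesis
    using linear_conv_bounded_linear bounded_linear_imp_has_derivative by blast
qed

lemma GDERIV_J:
  fixes X :: "real^'n^'m" and W :: "real^'k^'m" and S :: "real^'n^'k"
  shows "GDERIV (J X) (W, S) :>
           ((W ** S - X) ** transpose S, transpose W ** (W ** S - X))"
proof -
  let ?E = "W ** S - X"
  have J: "J X = (\<lambda>z. ((fst z ** snd z - X) \<bullet> (fst z ** snd z - X)) / 2)"
    by (auto simp: J_def power2_norm_eq_inner fun_eq_iff inner_diff_left inner_diff_right inner_commute)
  have D: "((\<lambda>z. fst z ** snd z - X) has_derivative (\<lambda>h. W ** snd h + fst h ** S)) (at (W, S))"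
    by (auto intro!: derivative_eq_intros
        bounded_bilinear.FDERIV[OF bounded_bilinear_matrix_mult])
  have "((\<lambda>z. ((fst z ** snd z - X) \<bullet> (fst z ** snd z - X)) / 2) has_derivative
        (\<lambda>h. (?E \<bullet> (W ** snd h + fst h ** S) + (W ** snd h + fst h ** S) \<bullet> ?E) / 2)) (at (W, S))"
    using bounded_linear.has_derivative[OF bounded_linear_divide[of 2] has_derivative_inner[OF D D]] by simp
  moreover have "(\<lambda>h. (?E \<bullet> (W ** snd h + fst h ** S) + (W ** snd h + fst h ** S) \<bullet> ?E) / 2)
      = (\<lambda>h. h \<bullet> (?E ** transpose S, transpose W ** ?E))"
  proof
    fix h :: "(real^'k^'m) \<times> (real^'n^'k)"
    have "(fst h ** S) \<bullet> ?E = fst h \<bullet> (?E ** transpose S)"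
      and "(W ** snd h) \<bullet> ?E = snd h \<bullet> (transpose W ** ?E)"
      by (rule inner_matrix_mult_left inner_matrix_mult_right)+
    then show "(?E \<bullet> (W ** snd h + fst h ** S) + (W ** snd h + fst h ** S) \<bullet> ?E) / 2
        = h \<bullet> (?E ** transpose S, transpose W ** ?E)"
      by (simp add: inner_prod_def inner_add_left inner_commute[of ?E])
  qed
  ultimately show ?thesis
    unfolding gderiv_def J by simp
qed

lemma gradient_eqI: "GDERIV f x :> D \<Longrightarrow> gradient f x = D"
  unfolding gradient_def gderiv_def
  by (rule the_equality)
     (auto dest: has_derivative_unique simp: fun_eq_iff vector_eq_ldot)

lemma gradient_J:
  fixes X :: "real^'n^'m" and W :: "real^'k^'m" and S :: "real^'n^'k"
  shows "gradient (J X) (W, S) = ((W ** S - X) ** transpose S, transpose W ** (W ** S - X))"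
  by (rule gradient_eqI[OF GDERIV_J])

lemma hessian_J_has_derivative:
  fixes X :: "real^'n^'m" and W :: "real^'k^'m" and S :: "real^'n^'k"
  defines "E \<equiv> W ** S - X"
  shows "(gradient (J X) has_derivative
           (\<lambda>(G, H). (G ** S ** transpose S + W ** H ** transpose S + E ** transpose H,
                      transpose W ** W ** H + transpose W ** G ** S + transpose G ** E)))
         (at (W, S))"
proof -
  have gr: "gradient (J X) = (\<lambda>z. ((fst z ** snd z - X) ** transpose (snd z),
                                     transpose (fst z) ** (fst z ** snd z - X)))"
    using gradient_J[of X] by (auto simp: fun_eq_iff)
  have D: "((\<lambda>z. fst z ** snd z - X) has_derivative (\<lambda>h. W ** snd h + fst h ** S)) (at (W, S))"
    by (auto intro!: derivative_eq_intros
        bounded_bilinear.FDERIV[OF bounded_bilinear_matrix_mult])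
  have T1: "((\<lambda>z. transpose (fst z)) has_derivative (\<lambda>h. transpose (fst h))) (at (W, S))"
    by (rule has_derivative_compose[OF has_derivative_fst[OF has_derivative_ident]
          transpose_has_derivative])
  have T2: "((\<lambda>z. transpose (snd z)) has_derivative (\<lambda>h. transpose (snd h))) (at (W, S))"
    by (rule has_derivative_compose[OF has_derivative_snd[OF has_derivative_ident]
          transpose_has_derivative])
  have "(gradient (J X) has_derivative
      (\<lambda>h. (E ** transpose (snd h) + (W ** snd h + fst h ** S) ** transpose S,
            transpose W ** (W ** snd h + fst h ** S) + transpose (fst h) ** E))) (at (W, S))"
    unfolding gr E_def
    using has_derivative_Pair[OF
        bounded_bilinear.FDERIV[OF bounded_bilinear_matrix_mult D T2]
        bounded_bilinear.FDERIV[OF bounded_bilinear_matrix_mult T1 D]]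
    by simp
  moreover have "(\<lambda>h. (E ** transpose (snd h) + (W ** snd h + fst h ** S) ** transpose S,
            transpose W ** (W ** snd h + fst h ** S) + transpose (fst h) ** E))
     = (\<lambda>(G, H). (G ** S ** transpose S + W ** H ** transpose S + E ** transpose H,
                      transpose W ** W ** H + transpose W ** G ** S + transpose G ** E))"
    by (auto simp: fun_eq_iff matrix_add_ldistrib mat_add_rdistrib matrix_mul_assoc)
  ultimately show ?thesis by simp
qed

lemma hessian_J:
  fixes X :: "real^'n^'m" and W :: "real^'k^'m" and S :: "real^'n^'k"
  defines "E \<equiv> W ** S - X"
  shows "hessian (J X) (W, S) (G, H) =
           (G ** S ** transpose S + W ** H ** transpose S + E ** transpose H,
            transpose W ** W ** H + transpose W ** G ** S + transpose G ** E)"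
  unfolding hessian_def E_def
  by (simp flip: frechet_derivative_at[OF hessian_J_has_derivative])

end

theory Submission
  imports Defs
begin

text \<open>At a point \<open>(W, S)\<close> with error \<open>E = WS - X\<close> the Hessian form is
  \<open>|WH + GS|\<^sup>2 + 2 \<langle>GH, E\<rangle>\<close>. At a canonical point \<open>E\<close> is minus the part of the singular value
  decomposition of \<open>X\<close> with unselected indices, so the second term couples only the components of
  \<open>G\<close> and \<open>H\<close> along unselected singular vectors. With \<open>weight c\<close> the squared norm of column \<open>c\<close> of
  \<open>W\<close>, the first term is at least the sum of \<open>weight c (g\<^sup>2 + h\<^sup>2)\<close> over these components. Hence the
  smallest eigenvalue is the minimum of \<open>weight c - \<sigma> i\<close> over columns \<open>c\<close> and unselected \<open>i\<close>,
  provided that this is not positive. The minimal weight is \<open>lam q\<close> or zero according to whether all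
  columns are used. The largest unselected singular value is \<open>\<sigma> t\<close>, with \<open>t\<close> the first gap, or
  \<open>q + 1\<close> at maximal points. Maximal points of full rank minimize \<open>J\<close> by the Eckart-Young bound:
  projecting onto the column space of \<open>W\<close> removes at most the \<open>k\<close> largest \<open>\<sigma>\<^sub>i\<^sup>2\<close>.\<close>

text \<open>Transposes stay explicit, so that columnwise rules such as
  \<open>column_matrix_mult\<close> apply to them.\<close>

declare transpose_matrix_vector [simp del] column_transpose [simp del]

section \<open>Orthonormal bases and the Frobenius inner product\<close>

text \<open>The difference \<open>d\<close> of both sides is orthogonal to every basis vector, hence
  to the whole space and to itself.\<close>

lemma orthonormal_basis_expand:
  fixes b :: "nat \<Rightarrow> 'a::euclidean_space"
  assumes "is_orthonormal_basis b"
  shows "(\<Sum>i = 1..DIM('a). (x \<bullet> b i) *\<^sub>R b i) = x"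
proof -
  define d where "d = x - (\<Sum>i = 1..DIM('a). (x \<bullet> b i) *\<^sub>R b i)"
  have "orthogonal d y" if y: "y \<in> b ` {1..DIM('a)}" for y
  proof -
    from y obtain j where j: "j \<in> {1..DIM('a)}" "y = b j" by auto
    have "(\<Sum>i = 1..DIM('a). (x \<bullet> b i) *\<^sub>R b i) \<bullet> b j
        = (\<Sum>i = 1..DIM('a). if i = j then x \<bullet> b i else 0)"
      unfolding inner_sum_left using assms j
      by (intro sum.cong) (auto simp: is_orthonormal_basis_def)
    also have "\<dots> = x \<bullet> b j" using j by simp
    finally show ?thesis by (simp add: orthogonal_def d_def j inner_diff_left)
  qed
  moreover have "d \<in> span (b ` {1..DIM('a)})"
    using assms by (simp add: is_orthonormal_basis_def)
  ultimately have "orthogonal d d" using orthogonal_to_span by blast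
  then show ?thesis by (simp add: d_def orthogonal_def)
qed

lemma orthonormal_basis_inner:
  fixes b :: "nat \<Rightarrow> 'a::euclidean_space"
  assumes "is_orthonormal_basis b"
  shows "x \<bullet> y = (\<Sum>i = 1..DIM('a). (x \<bullet> b i) * (y \<bullet> b i))"
  by (subst orthonormal_basis_expand[OF assms, of x, symmetric])
     (simp add: inner_sum_left inner_commute[of y])

lemma orthonormal_basis_norm:
  fixes b :: "nat \<Rightarrow> 'a::euclidean_space"
  assumes "is_orthonormal_basis b"
  shows "x \<bullet> x = (\<Sum>i = 1..DIM('a). (x \<bullet> b i)\<^sup>2)"
  by (subst orthonormal_basis_inner[OF assms]) (simp add: power2_eq_square)

text \<open>Parseval for each row: the Frobenius inner product may be computed in any orthonormal
  basis of the domain.\<close>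

lemma inner_matrix_orthonormal:
  fixes A B :: "real^'n^'m"
  assumes "is_orthonormal_basis v"
  shows "A \<bullet> B = (\<Sum>j = 1..CARD('n). (A *v v j) \<bullet> (B *v v j))"
proof -
  have "A \<bullet> B = (\<Sum>i\<in>UNIV. \<Sum>j = 1..CARD('n). (A $ i \<bullet> v j) * (B $ i \<bullet> v j))"
    unfolding inner_vec_def[of A] by (subst orthonormal_basis_inner[OF assms]) simp
  also have "\<dots> = (\<Sum>j = 1..CARD('n). \<Sum>i\<in>UNIV. (A $ i \<bullet> v j) * (B $ i \<bullet> v j))"
    by (rule sum.swap)
  finally show ?thesis
    by (simp add: inner_vec_def[of "A *v _"] matrix_vector_mul_component)
qed

lemma orthogonal_sum_inner_self:
  fixes f :: "'i::finite \<Rightarrow> 'a::real_inner"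
  assumes orth: "\<And>c d. f c \<bullet> f d = (if c = d then g c else 0)"
  shows "(\<Sum>c\<in>UNIV. x c *\<^sub>R f c) \<bullet> (\<Sum>c\<in>UNIV. x c *\<^sub>R f c) = (\<Sum>c\<in>UNIV. g c * (x c)\<^sup>2)"
proof -
  have "f c \<bullet> (\<Sum>d\<in>UNIV. x d *\<^sub>R f d) = x c * g c" for c
  proof -
    have "f c \<bullet> (\<Sum>d\<in>UNIV. x d *\<^sub>R f d) = (\<Sum>d\<in>UNIV. if c = d then x d * g c else 0)"
      unfolding inner_sum_right by (intro sum.cong refl) (simp add: orth)
    then show ?thesis by simp
  qed
  then show ?thesis
    by (subst inner_sum_left) (simp add: power2_eq_square mult_ac)
qed

lemma inner_matrix_columns:
  fixes A B :: "real^'n^'m"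
  shows "A \<bullet> B = (\<Sum>c\<in>UNIV. column c A \<bullet> column c B)"
  by (simp add: inner_vec_def column_def) (rule sum.swap)

lemma column_matrix_mult:
  fixes A :: "real^'k^'m" and B :: "real^'n^'k"
  shows "column c (A ** B) = A *v column c B"
  by (simp add: vec_eq_iff column_def matrix_matrix_mult_def matrix_vector_mult_def)

lemma matrix_eq_columns:
  fixes A B :: "real^'n^'m"
  shows "A = B \<longleftrightarrow> (\<forall>c. column c A = column c B)"
  by (auto simp: vec_eq_iff column_def)

lemma matrix_vector_mult_columns:
  fixes A :: "real^'n^'m"
  shows "A *v x = (\<Sum>c\<in>UNIV. (x $ c) *\<^sub>R column c A)"
  by (simp add: vec_eq_iff column_def matrix_vector_mult_def mult.commute)

section \<open>Low-rank approximation\<close>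

text \<open>\<open>P\<close> is the orthogonal projection of \<open>x\<close> onto
  \<open>span B\<close>, the nearest point there. The second claim is Bessel's inequality.\<close>

lemma orthonormal_set_projection:
  fixes x :: "'a::euclidean_space"
  assumes "finite B" and orth: "\<And>a b. a \<in> B \<Longrightarrow> b \<in> B \<Longrightarrow> a \<bullet> b = (if a = b then 1 else 0)"
    and y: "y \<in> span B"
  shows "(norm x)\<^sup>2 - (\<Sum>b\<in>B. (b \<bullet> x)\<^sup>2) \<le> (norm (x - y))\<^sup>2"
    and "(\<Sum>b\<in>B. (b \<bullet> x)\<^sup>2) \<le> (norm x)\<^sup>2"
proof -
  define P where "P = (\<Sum>b\<in>B. (b \<bullet> x) *\<^sub>R b)"
  have Pb: "P \<bullet> a = a \<bullet> x" if "a \<in> B" for a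
  proof -
    have "P \<bullet> a = (\<Sum>b\<in>B. if b = a then b \<bullet> x else 0)"
      unfolding P_def inner_sum_left by (intro sum.cong refl) (simp add: orth that)
    then show ?thesis using that \<open>finite B\<close> by simp
  qed
  have o: "orthogonal (x - P) z" if "z \<in> span B" for z
    by (rule orthogonal_to_span[OF that]) (simp add: orthogonal_def inner_diff_left Pb inner_commute[of x])
  have PB: "P \<in> span B" unfolding P_def by (intro span_sum span_scale span_base)
  have PP: "P \<bullet> P = (\<Sum>b\<in>B. (b \<bullet> x)\<^sup>2)"
    by (subst (2) P_def) (simp add: inner_sum_right Pb power2_eq_square)
  have xP: "x \<bullet> P = P \<bullet> P" using o[OF PB] by (simp add: orthogonal_def inner_diff_left)
  have d: "(norm (x - P))\<^sup>2 = (norm x)\<^sup>2 - (\<Sum>b\<in>B. (b \<bullet> x)\<^sup>2)"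
    by (simp add: power2_norm_eq_inner inner_diff_left inner_diff_right inner_commute[of P x] xP PP)
  have "(norm (x - y))\<^sup>2 = (norm (x - P))\<^sup>2 + (norm (P - y))\<^sup>2"
    using norm_add_Pythagorean[OF o, of "P - y"] PB y by (simp add: span_diff)
  then show "(norm x)\<^sup>2 - (\<Sum>b\<in>B. (b \<bullet> x)\<^sup>2) \<le> (norm (x - y))\<^sup>2" using d by simp
  show "(\<Sum>b\<in>B. (b \<bullet> x)\<^sup>2) \<le> (norm x)\<^sup>2" using d by (metis diff_ge_0_iff_ge zero_le_power2)
qed

text \<open>A weight budget \<open>k\<close> with at most 1 per entry is best spent on the
  \<open>k\<close> largest entries. After subtracting the threshold \<open>a k\<close>, entries
  beyond \<open>k\<close> contribute nothing positive.\<close>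

lemma weighted_sum_le_top_sum:
  fixes a w :: "nat \<Rightarrow> real"
  assumes "k \<le> m" "1 \<le> k"
    and anti: "\<And>i j. 1 \<le> i \<Longrightarrow> i \<le> j \<Longrightarrow> j \<le> m \<Longrightarrow> a j \<le> a i"
    and nonneg: "0 \<le> a k"
    and w: "\<And>i. i \<in> {1..m} \<Longrightarrow> 0 \<le> w i \<and> w i \<le> 1" and W: "sum w {1..m} \<le> real k"
  shows "(\<Sum>i = 1..m. a i * w i) \<le> (\<Sum>i = 1..k. a i)"
proof -
  have "(\<Sum>i = 1..m. (a i - a k) * w i) \<le> (\<Sum>i = 1..m. if i \<in> {1..k} then a i - a k else 0)"
  proof (intro sum_mono)
    fix i assume i: "i \<in> {1..m}"
    show "(a i - a k) * w i \<le> (if i \<in> {1..k} then a i - a k else 0)"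
    proof (cases "i \<le> k")
      case True
      then have "a k \<le> a i" using anti[of i k] i assms by auto
      then show ?thesis using True i w[OF i] by (auto intro: mult_left_le)
    next
      case False
      then have "a i \<le> a k" using anti[of k i] i assms by auto
      then show ?thesis using False w[OF i] by (auto intro: mult_nonpos_nonneg)
    qed
  qed
  also have "\<dots> = (\<Sum>i = 1..k. a i - a k)"
    using \<open>k \<le> m\<close> by (subst sum.inter_restrict[symmetric]) (auto intro!: sum.cong)
  finally have "(\<Sum>i = 1..m. a i * w i) - a k * sum w {1..m} \<le> (\<Sum>i = 1..k. a i) - k * a k"
    by (simp add: sum_subtractf left_diff_distrib sum_distrib_left)
  \<comment> \<open>The budget may be underspent; this costs nothing because \<open>a k\<close> is
    nonnegative.\<close>
  moreover have "a k * sum w {1..m} \<le> a k * k" using nonneg W by (rule mult_left_mono[rotated])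
  ultimately show ?thesis by (simp add: mult.commute)
qed

lemma svd_antimono:
  fixes X :: "real^'n^'m"
  assumes "is_full_svd X \<sigma> u v" "1 \<le> i" "i \<le> j" "j \<le> CARD('m)"
  shows "\<sigma> j \<le> \<sigma> i"
  using assms by (auto simp: is_full_svd_def)

text \<open>The Eckart-Young lower bound. Every vector \<open>(W ** S) *v x\<close> lies in the
  column space of \<open>W\<close>, so the error on \<open>v j\<close> is at least the distance of
  \<open>X *v v j\<close> from that space.\<close>

lemma low_rank_error_ge:
  fixes X :: "real^'n^'m" and W :: "real^'k^'m" and S :: "real^'n^'k"
  assumes svd: "is_full_svd X \<sigma> u v" and "CARD('m) < CARD('n)" and km: "CARD('k) \<le> CARD('m)"
  shows "(\<Sum>i = 1..CARD('m). (\<sigma> i)\<^sup>2) - (\<Sum>i = 1..CARD('k). (\<sigma> i)\<^sup>2) \<le> (norm (X - W ** S))\<^sup>2"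
proof -
  obtain B :: "(real^'m) set" where B: "pairwise orthogonal B" "\<And>x. x \<in> B \<Longrightarrow> norm x = 1"
      "independent B" "card B = dim (range (\<lambda>c. column c W))"
      "span B = span (range (\<lambda>c. column c W))"
    using orthonormal_basis_subspace[OF subspace_span, of "range (\<lambda>c. column c W)"]
    by (metis dim_span span_eq_iff subspace_span)
  have fin: "finite B" using B(3) by (rule independent_imp_finite)
  have orth: "a \<bullet> b = (if a = b then 1 else 0)" if "a \<in> B" "b \<in> B" for a b
    using B(1,2) that by (auto simp: pairwise_def orthogonal_def norm_eq_1)
  have cardB: "card B \<le> CARD('k)"
    using dim_le_card'[of "range (\<lambda>c. column c W)"] card_image_le[of UNIV "\<lambda>c. column c W"] B(4)
    by simp
  have ub: "is_orthonormal_basis u" and vb: "is_orthonormal_basis v"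
    using svd by (auto simp: is_full_svd_def)
  have un: "norm (u j) = 1" if "j \<in> {1..CARD('m)}" for j
    using ub that by (auto simp: is_orthonormal_basis_def norm_eq_1)
  have rg: "(W ** S) *v x \<in> span B" for x
    unfolding matrix_vector_mul_assoc[symmetric] B(5)
    by (subst matrix_vector_mult_columns) (auto intro!: span_sum span_scale intro: span_base)
  \<comment> \<open>The squared length of the projection of \<open>u i\<close> onto the column space
    of \<open>W\<close>.\<close>
  define w where "w i = (\<Sum>b\<in>B. (b \<bullet> u i)\<^sup>2)" for i
  have w01: "0 \<le> w i \<and> w i \<le> 1" if "i \<in> {1..CARD('m)}" for i
    using orthonormal_set_projection(2)[OF fin orth span_zero, of "u i"] un[OF that]
    by (auto simp: w_def intro: sum_nonneg)
  \<comment> \<open>The total weight is the trace of the projection, that is, its rank.\<close>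
  have "sum w {1..CARD('m)} = (\<Sum>b\<in>B. \<Sum>i = 1..CARD('m). (b \<bullet> u i)\<^sup>2)"
    unfolding w_def by (rule sum.swap)
  also have "\<dots> = (\<Sum>b\<in>B. b \<bullet> b)"
    using orthonormal_basis_norm[OF ub] by simp
  also have "\<dots> = card B" by (simp add: orth)
  finally have W: "sum w {1..CARD('m)} \<le> CARD('k)" using cardB by simp
  have sqanti: "(\<sigma> j)\<^sup>2 \<le> (\<sigma> i)\<^sup>2" if "1 \<le> i" "i \<le> j" "j \<le> CARD('m)" for i j
    using svd_antimono[OF svd that] svd that by (intro power_mono) (auto simp: is_full_svd_def)
  have top: "(\<Sum>i = 1..CARD('m). (\<sigma> i)\<^sup>2 * w i) \<le> (\<Sum>i = 1..CARD('k). (\<sigma> i)\<^sup>2)"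
    by (rule weighted_sum_le_top_sum[OF km _ sqanti _ w01 W]) auto
  have "(\<Sum>i = 1..CARD('m). (\<sigma> i)\<^sup>2) - (\<Sum>i = 1..CARD('m). (\<sigma> i)\<^sup>2 * w i)
      = (\<Sum>j = 1..CARD('m). (norm (X *v v j))\<^sup>2 - (\<Sum>b\<in>B. (b \<bullet> (X *v v j))\<^sup>2))"
    unfolding sum_subtractf[symmetric] using svd un
    by (intro sum.cong refl)
       (auto simp: is_full_svd_def w_def sum_distrib_left power_mult_distrib)
  also have "\<dots> \<le> (\<Sum>j = 1..CARD('m). (norm (X *v v j - (W ** S) *v v j))\<^sup>2)"
    by (intro sum_mono orthonormal_set_projection(1)[OF fin orth rg])
  also have "\<dots> \<le> (\<Sum>j = 1..CARD('n). (norm ((X - W ** S) *v v j))\<^sup>2)"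
    unfolding matrix_vector_mult_diff_rdistrib
    using assms(2) by (intro sum_mono2) auto
  also have "\<dots> = (norm (X - W ** S))\<^sup>2"
    by (simp add: power2_norm_eq_inner inner_matrix_orthonormal[OF vb, of "X - W ** S"])
  finally show ?thesis using top by linarith
qed

section \<open>The largest unselected singular value\<close>

abbreviation unselected :: "nat \<Rightarrow> (nat \<Rightarrow> nat) \<Rightarrow> nat \<Rightarrow> nat set" where
  "unselected m idx q \<equiv> {1..m} - idx ` {1..q}"

text \<open>Pigeonhole: the first \<open>j\<close> selected indices are distinct, so one of them,
  \<open>idx i\<close>, is at least \<open>j\<close>. Then \<open>lam j\<close> is at most
  \<open>lam i = \<sigma> (idx i)\<close>, hence at most \<open>\<sigma> j\<close>.\<close>

lemma sorted_selection_le: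
  fixes \<sigma> lam :: "nat \<Rightarrow> real"
  assumes sel: "is_selection \<sigma> r q idx lam" and "r \<le> m" "j \<in> {1..q}"
    and anti: "\<And>i j. 1 \<le> i \<Longrightarrow> i \<le> j \<Longrightarrow> j \<le> m \<Longrightarrow> \<sigma> j \<le> \<sigma> i"
  shows "lam j \<le> \<sigma> j"
proof -
  have "\<not> idx ` {1..j} \<subseteq> {1..<j}"
  proof
    assume "idx ` {1..j} \<subseteq> {1..<j}"
    moreover have "inj_on idx {1..j}"
      using sel assms(3) by (auto simp: is_selection_def intro: inj_on_subset)
    ultimately have "card {1..j} \<le> card {1..<j}" by (intro card_inj_on_le) auto
    then show False using assms(3) by (cases j) auto
  qed
  then obtain i where i: "i \<in> {1..j}" "idx i \<notin> {1..<j}" by blast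
  have iq: "i \<in> {1..q}" using i assms(3) by auto
  then have ir: "idx i \<in> {1..r}" using sel unfolding is_selection_def by blast
  have "lam j \<le> lam i" using sel i iq assms(3) by (auto simp: is_selection_def)
  also have "\<dots> = \<sigma> (idx i)" using sel iq by (simp add: is_selection_def)
  also have "\<dots> \<le> \<sigma> j" using i ir assms(2,3) by (intro anti) auto
  finally show ?thesis .
qed

text \<open>Applied with \<open>t\<close> the first gap or \<open>q + 1\<close>. Ties allow
  \<open>idx j\<close> to differ from \<open>j\<close> even where \<open>lam j = \<sigma> j\<close>,
  so the argument compares values rather than indices.\<close>

lemma largest_unselected:
  fixes \<sigma> lam :: "nat \<Rightarrow> real"
  assumes sel: "is_selection \<sigma> r q idx lam" and "r \<le> m" and t: "1 \<le> t" "t \<le> m" "t \<le> q + 1"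
    and anti: "\<And>i j. 1 \<le> i \<Longrightarrow> i \<le> j \<Longrightarrow> j \<le> m \<Longrightarrow> \<sigma> j \<le> \<sigma> i"
    and below: "\<And>j. 1 \<le> j \<Longrightarrow> j < t \<Longrightarrow> lam j = \<sigma> j"
    and above: "\<And>j. t \<le> j \<Longrightarrow> j \<le> q \<Longrightarrow> lam j < \<sigma> t"
  shows "\<forall>i\<in>unselected m idx q. \<sigma> i \<le> \<sigma> t"
    and "\<exists>i\<in>unselected m idx q. \<sigma> i = \<sigma> t"
proof -
  have inj: "inj_on idx {1..q}" and sub: "idx ` {1..q} \<subseteq> {1..m}"
    and lam: "\<And>j. j \<in> {1..q} \<Longrightarrow> lam j = \<sigma> (idx j)"
    using sel \<open>r \<le> m\<close> by (auto simp: is_selection_def)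
  define A where "A = {i \<in> {1..m}. \<sigma> t < \<sigma> i}"
  have At: "j < t" if "j \<in> A" for j
    using that anti[of t j] t unfolding A_def by (cases "j < t") auto
  have Aq: "A \<subseteq> {1..q}" using At t by (fastforce simp: A_def)
  have "idx ` A \<subseteq> A"
  proof (intro image_subsetI)
    fix j assume j: "j \<in> A"
    have "\<sigma> (idx j) = \<sigma> j" using lam[of j] below[OF _ At[OF j]] j Aq by auto
    then show "idx j \<in> A" using j sub Aq unfolding A_def by (auto simp: image_subset_iff)
  qed
  \<comment> \<open>An injective self-map of a finite set is onto, so every index with value above
    \<open>\<sigma> t\<close> is selected.\<close>
  then have "idx ` A = A"
    using inj_on_subset[OF inj Aq] by (intro endo_inj_surj) (simp_all add: A_def)
  then have "A \<subseteq> idx ` {1..q}" using Aq by blast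
  then show ub: "\<forall>i\<in>unselected m idx q. \<sigma> i \<le> \<sigma> t"
    unfolding A_def by (force simp: not_le[symmetric])
  \<comment> \<open>The first \<open>t - 1\<close> selections miss some \<open>i\<close> in
    \<open>{1..t}\<close>; later ones have values below \<open>\<sigma> t\<close> and miss it
    too.\<close>
  have "card (idx ` {1..<t}) \<le> card {1..<t}" by (rule card_image_le) simp
  also have "\<dots> < card {1..t}" using t by simp
  finally have "\<not> {1..t} \<subseteq> idx ` {1..<t}"
    using card_mono[of "idx ` {1..<t}" "{1..t}"] by auto
  then obtain i where i: "i \<in> {1..t}" "i \<notin> idx ` {1..<t}" by blast
  have le: "\<sigma> t \<le> \<sigma> i" using anti i t by auto
  have "i \<notin> idx ` {1..q}"
  proof
    assume "i \<in> idx ` {1..q}"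
    then obtain j where j: "j \<in> {1..q}" "i = idx j" by auto
    then have "t \<le> j" using i by (auto simp: not_less[symmetric])
    then show False using above[of j] lam[of j] j le by auto
  qed
  then have "i \<in> unselected m idx q" using i t by auto
  then show "\<exists>i\<in>unselected m idx q. \<sigma> i = \<sigma> t" using ub le by (metis order_antisym)
qed

section \<open>The Hessian at a canonical point\<close>

text \<open>A lower bound on the quadratic form bounds every eigenvalue; that it is attained makes
  the \<open>LEAST\<close> meaningful.\<close>

lemma lambda_min_eqI:
  fixes T :: "'a::real_inner \<Rightarrow> 'a"
  assumes "is_eigenvalue T \<mu>" and "\<And>x. \<mu> * (x \<bullet> x) \<le> x \<bullet> T x"
  shows "lambda_min T = \<mu>"
  unfolding lambda_min_def
proof (rule Least_equality)
  fix \<nu> assume "is_eigenvalue T \<nu>"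
  then obtain x where x: "x \<noteq> 0" "T x = \<nu> *\<^sub>R x" by (auto simp: is_eigenvalue_def)
  have "\<mu> * (x \<bullet> x) \<le> \<nu> * (x \<bullet> x)" using assms(2)[of x] x by simp
  then show "\<mu> \<le> \<nu>" using x by simp
qed fact

text \<open>\<open>M\<close> is the first-order change of \<open>W ** S\<close>. By adjointness,
  both error terms of the Hessian pair to the same number
  \<open>(G ** H) \<bullet> E\<close>.\<close>

lemma hessian_J_form:
  fixes X :: "real^'n^'m" and W G :: "real^'k^'m" and S H :: "real^'n^'k"
  defines "E \<equiv> W ** S - X" and "M \<equiv> W ** H + G ** S"
  shows "(G, H) \<bullet> hessian (J X) (W, S) (G, H) = M \<bullet> M + 2 * ((G ** H) \<bullet> E)"
proof -
  have "hessian (J X) (W, S) (G, H)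
      = (M ** transpose S + E ** transpose H, transpose W ** M + transpose G ** E)"
    unfolding hessian_J E_def M_def
    by (simp add: mat_add_rdistrib matrix_add_ldistrib matrix_mul_assoc add.commute)
  then show ?thesis
    by (simp add: inner_add_right inner_matrix_mult_left[symmetric] inner_matrix_mult_right[symmetric])
       (simp add: M_def inner_add_left)
qed

section \<open>Factors and weights of a balanced canonical point\<close>

locale svd_selection =
  fixes X :: "real^'n^'m" and \<sigma> lam :: "nat \<Rightarrow> real" and u :: "nat \<Rightarrow> real^'m"
    and v :: "nat \<Rightarrow> real^'n" and idx :: "nat \<Rightarrow> nat" and r q :: nat and col :: "'k::finite \<Rightarrow> nat"
  assumes svd: "is_full_svd X \<sigma> u v" and sel: "is_selection \<sigma> r q idx lam"
    and col: "bij_betw col UNIV {1..CARD('k)}" and qk: "q \<le> CARD('k)"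
    and rm: "r \<le> CARD('m)" and mn: "CARD('m) < CARD('n)"
begin

definition w :: "'k \<Rightarrow> real^'m" where
  "w c = (if col c \<le> q then sqrt (lam (col c)) *\<^sub>R u (idx (col c)) else 0)"

definition s :: "'k \<Rightarrow> real^'n" where
  "s c = (if col c \<le> q then sqrt (lam (col c)) *\<^sub>R v (idx (col c)) else 0)"

text \<open>The common diagonal entries of \<open>transpose W ** W\<close> and
  \<open>S ** transpose S\<close>.\<close>

definition weight :: "'k \<Rightarrow> real" where
  "weight c = (if col c \<le> q then lam (col c) else 0)"

definition W :: "real^'k^'m" where "W = (\<chi> a c. w c $ a)"

definition S :: "real^'n^'k" where "S = (\<chi> c. s c)"

definition E :: "real^'n^'m" where "E = W ** S - X"

lemma canonical_point_eq: "canonical_point col u v q idx lam = (W, S)"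
  by (auto simp: canonical_point_def W_def S_def w_def s_def vec_eq_iff)

lemma column_W: "column c W = w c"
  by (simp add: W_def column_def vec_eq_iff)

lemma column_transpose_S: "column c (transpose S) = s c"
  by (simp add: S_def column_def transpose_def vec_eq_iff)

lemma W_mult: "W *v x = (\<Sum>c\<in>UNIV. (x $ c) *\<^sub>R w c)"
  by (simp add: matrix_vector_mult_columns column_W)

lemma transpose_S_mult: "transpose S *v x = (\<Sum>c\<in>UNIV. (x $ c) *\<^sub>R s c)"
  by (simp add: matrix_vector_mult_columns column_transpose_S)

lemma S_mult: "(S *v x) $ c = s c \<bullet> x"
  by (simp add: S_def matrix_vector_mul_component)

lemma transpose_W_mult: "(transpose W *v x) $ c = w c \<bullet> x"
  by (simp add: W_def transpose_def matrix_vector_mul_component inner_vec_def)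

lemma ub: "is_orthonormal_basis u" and vb: "is_orthonormal_basis v"
  using svd by (auto simp: is_full_svd_def)

lemma u_inner: "i \<in> {1..CARD('m)} \<Longrightarrow> j \<in> {1..CARD('m)} \<Longrightarrow> u i \<bullet> u j = (if i = j then 1 else 0)"
  using ub by (auto simp: is_orthonormal_basis_def)

lemma v_inner: "i \<in> {1..CARD('n)} \<Longrightarrow> j \<in> {1..CARD('n)} \<Longrightarrow> v i \<bullet> v j = (if i = j then 1 else 0)"
  using vb by (auto simp: is_orthonormal_basis_def)

lemma col_pos: "1 \<le> col c"
  using bij_betwE[OF col] by force

lemma col_eq: "col c = col d \<longleftrightarrow> c = d"
  using col by (auto simp: bij_betw_def inj_def)

lemma col_surj:
  assumes "1 \<le> j" "j \<le> CARD('k)" shows "\<exists>c. col c = j"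
proof -
  have "j \<in> range col" using assms col by (simp add: bij_betw_def)
  then show ?thesis by blast
qed

lemma idx_range:
  assumes "col c \<le> q" shows "idx (col c) \<in> {1..CARD('m)}"
proof -
  have "idx (col c) \<in> idx ` {1..q}" using assms col_pos[of c] by auto
  then have "idx (col c) \<in> {1..r}" using sel unfolding is_selection_def by blast
  then show ?thesis using rm by auto
qed

lemma idx_range_n: "col c \<le> q \<Longrightarrow> idx (col c) \<in> {1..CARD('n)}"
  using idx_range[of c] mn by auto

lemma idx_eq: "col c \<le> q \<Longrightarrow> col d \<le> q \<Longrightarrow> idx (col c) = idx (col d) \<longleftrightarrow> c = d"
  using sel col_pos[of c] col_pos[of d] unfolding is_selection_def
  by (auto simp: inj_on_eq_iff col_eq)

lemma idx_in: "col c \<le> q \<Longrightarrow> idx (col c) \<in> idx ` {1..q}"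
  using col_pos[of c] by auto

lemma idx_surj:
  assumes "i \<in> idx ` {1..q}" shows "\<exists>c. col c \<le> q \<and> i = idx (col c)"
proof -
  obtain j where j: "j \<in> {1..q}" "i = idx j" using assms by auto
  obtain c where "col c = j" using col_surj[of j] j qk by auto
  then show ?thesis using j by auto
qed

lemma lam_pos: "col c \<le> q \<Longrightarrow> 0 < lam (col c)"
  and lam_idx: "col c \<le> q \<Longrightarrow> lam (col c) = \<sigma> (idx (col c))"
proof -
  assume "col c \<le> q"
  then have "col c \<in> {1..q}" using col_pos[of c] by simp
  then show "0 < lam (col c)" "lam (col c) = \<sigma> (idx (col c))"
    using sel unfolding is_selection_def by blast+
qed

lemma u_idx_inner:
    "col c \<le> q \<Longrightarrow> col d \<le> q \<Longrightarrow> u (idx (col c)) \<bullet> u (idx (col d)) = (if c = d then 1 else 0)"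
  and v_idx_inner:
    "col c \<le> q \<Longrightarrow> col d \<le> q \<Longrightarrow> v (idx (col c)) \<bullet> v (idx (col d)) = (if c = d then 1 else 0)"
  by (simp_all only: u_inner[OF idx_range idx_range] v_inner[OF idx_range_n idx_range_n] idx_eq)

lemma weight_nonneg: "0 \<le> weight c"
  using lam_pos[of c] by (auto simp: weight_def)

lemma w_inner: "w c \<bullet> w d = (if c = d then weight c else 0)"
  using lam_pos[of c] by (auto simp: w_def weight_def u_idx_inner)

lemma s_inner: "s c \<bullet> s d = (if c = d then weight c else 0)"
  using lam_pos[of c] by (auto simp: s_def weight_def v_idx_inner)

lemma w_orth: "i \<in> unselected CARD('m) idx q \<Longrightarrow> w c \<bullet> u i = 0"
  using idx_in[of c] idx_range[of c] by (auto simp: w_def u_inner)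

lemma s_orth: "j \<in> {1..CARD('n)} - idx ` {1..q} \<Longrightarrow> s c \<bullet> v j = 0"
  using idx_in[of c] idx_range_n[of c] by (auto simp: s_def v_inner)

lemma X_v: "i \<in> {1..CARD('m)} \<Longrightarrow> X *v v i = \<sigma> i *\<^sub>R u i"
  and X_u: "i \<in> {1..CARD('m)} \<Longrightarrow> transpose X *v u i = \<sigma> i *\<^sub>R v i"
  and X_v0: "i \<in> {CARD('m)<..CARD('n)} \<Longrightarrow> X *v v i = 0"
  using svd by (auto simp: is_full_svd_def)

section \<open>The error matrix on singular vectors\<close>

text \<open>On a selected vector \<open>W ** S\<close> acts like \<open>X\<close>, because the two
  square roots multiply to the singular value.\<close>

lemma E_v_selected: "col c \<le> q \<Longrightarrow> E *v v (idx (col c)) = 0"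
proof -
  assume c: "col c \<le> q"
  have "(W ** S) *v v (idx (col c)) = (\<Sum>d\<in>UNIV. (s d \<bullet> v (idx (col c))) *\<^sub>R w d)"
    by (simp add: matrix_vector_mul_assoc[symmetric] W_mult S_mult)
  also have "\<dots> = (\<Sum>d\<in>UNIV. if d = c then \<sigma> (idx (col c)) *\<^sub>R u (idx (col c)) else 0)"
    using lam_pos[OF c] lam_idx[OF c]
    by (intro sum.cong refl) (auto simp: s_def w_def v_idx_inner c)
  finally show ?thesis
    using X_v[OF idx_range[OF c]] by (simp add: E_def matrix_vector_mult_diff_rdistrib)
qed

lemma transpose_E: "transpose E = transpose S ** transpose W - transpose X"
proof -
  have "transpose (A - B) = transpose A - transpose B" for A B :: "real^'n^'m"
    by (simp add: transpose_def vec_eq_iff)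
  then show ?thesis by (simp add: E_def matrix_transpose_mul)
qed

lemma E_u_selected: "col c \<le> q \<Longrightarrow> transpose E *v u (idx (col c)) = 0"
proof -
  assume c: "col c \<le> q"
  have "(transpose S ** transpose W) *v u (idx (col c))
      = (\<Sum>d\<in>UNIV. (w d \<bullet> u (idx (col c))) *\<^sub>R s d)"
    by (simp add: matrix_vector_mul_assoc[symmetric] transpose_S_mult transpose_W_mult)
  also have "\<dots> = (\<Sum>d\<in>UNIV. if d = c then \<sigma> (idx (col c)) *\<^sub>R v (idx (col c)) else 0)"
    using lam_pos[OF c] lam_idx[OF c]
    by (intro sum.cong refl) (auto simp: s_def w_def u_idx_inner c)
  finally show ?thesis
    using X_u[OF idx_range[OF c]] by (simp add: transpose_E matrix_vector_mult_diff_rdistrib)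
qed

lemma E_v_unselected:
  assumes "j \<in> {1..CARD('n)} - idx ` {1..q}"
  shows "E *v v j = (if j \<in> unselected CARD('m) idx q then - \<sigma> j *\<^sub>R u j else 0)"
proof -
  have "(W ** S) *v v j = 0"
    by (simp add: matrix_vector_mul_assoc[symmetric] W_mult S_mult s_orth[OF assms])
  then show ?thesis
    using X_v[of j] X_v0[of j] assms by (auto simp: E_def matrix_vector_mult_diff_rdistrib)
qed

lemma E_u_unselected:
  assumes "i \<in> unselected CARD('m) idx q" shows "transpose E *v u i = - \<sigma> i *\<^sub>R v i"
proof -
  have "(transpose S ** transpose W) *v u i = 0"
    by (simp add: matrix_vector_mul_assoc[symmetric] transpose_S_mult transpose_W_mult w_orth[OF assms])
  then show ?thesis
    using X_u[of i] assms by (auto simp: transpose_E matrix_vector_mult_diff_rdistrib)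
qed

text \<open>\<open>E\<close> is thus minus the unselected part of the singular value decomposition;
  the vectors \<open>v j\<close> with \<open>j\<close> above \<open>CARD('m)\<close> fall under the
  zero case.\<close>

lemma E_v:
  assumes "j \<in> {1..CARD('n)}"
  shows "E *v v j = (if j \<in> unselected CARD('m) idx q then - \<sigma> j *\<^sub>R u j else 0)"
proof (cases "j \<in> idx ` {1..q}")
  case True
  then show ?thesis using idx_surj[OF True] E_v_selected by auto
next
  case False
  then show ?thesis using E_v_unselected assms by auto
qed

lemma E_s: "E *v s c = 0"
  by (simp add: s_def matrix_vector_mult_scaleR E_v_selected)

lemma E_w: "transpose E *v w c = 0"
  by (simp add: w_def matrix_vector_mult_scaleR E_u_selected)

section \<open>Criticality, balancedness and the objective value\<close>

text \<open>The columns of \<open>W\<close> and rows of \<open>S\<close> are multiples of selected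
  singular vectors, which the error annihilates from either side.\<close>

lemma gradient_zero: "gradient (J X) (W, S) = 0"
proof -
  have "E ** transpose S = 0"
    by (simp add: matrix_eq_columns column_matrix_mult column_transpose_S E_s)
       (simp add: column_def vec_eq_iff)
  moreover have "transpose E ** W = 0"
    by (simp add: matrix_eq_columns column_matrix_mult column_W E_w)
       (simp add: column_def vec_eq_iff)
  then have "transpose (transpose E ** W) = 0" by (simp add: transpose_def vec_eq_iff)
  then have "transpose W ** E = 0" by (simp add: matrix_transpose_mul)
  ultimately show ?thesis by (simp add: gradient_J E_def zero_prod_def)
qed

lemma WW: "column c (transpose W ** W) = weight c *\<^sub>R axis c 1"
  by (auto simp: column_matrix_mult column_W vec_eq_iff transpose_W_mult w_inner axis_def)

lemma SS: "column c (S ** transpose S) = weight c *\<^sub>R axis c 1"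
  by (auto simp: column_matrix_mult column_transpose_S vec_eq_iff S_mult s_inner axis_def)

lemma balanced: "(W, S) \<in> M0"
  by (simp add: M0_def matrix_eq_columns WW SS)

lemma error_eq: "(norm E)\<^sup>2 = (\<Sum>i\<in>unselected CARD('m) idx q. (\<sigma> i)\<^sup>2)"
proof -
  have "(norm E)\<^sup>2 = (\<Sum>j = 1..CARD('n). (E *v v j) \<bullet> (E *v v j))"
    by (simp add: power2_norm_eq_inner inner_matrix_orthonormal[OF vb, of E])
  also have "\<dots> = (\<Sum>j = 1..CARD('n). if j \<in> unselected CARD('m) idx q then (\<sigma> j)\<^sup>2 else 0)"
    by (intro sum.cong refl) (auto simp: E_v u_inner power2_eq_square)
  also have "\<dots> = (\<Sum>j\<in>{1..CARD('n)} \<inter> unselected CARD('m) idx q. (\<sigma> j)\<^sup>2)"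
    by (subst sum.inter_restrict) auto
  also have "{1..CARD('n)} \<inter> unselected CARD('m) idx q = unselected CARD('m) idx q" using mn by auto
  finally show ?thesis .
qed

lemma J_eq: "J X (W, S) = (\<Sum>i\<in>unselected CARD('m) idx q. (\<sigma> i)\<^sup>2) / 2"
  using error_eq by (simp add: J_def E_def norm_minus_commute)

text \<open>The entries of \<open>M = WH + GS\<close> in the singular bases vanish when both indices are unselected, so
  the mass in the unselected columns and the mass in the unselected rows do not overlap.\<close>

lemma cross_term_ge:
  fixes G :: "real^'k^'m" and H :: "real^'n^'k"
  defines "M \<equiv> W ** H + G ** S"
  shows "(\<Sum>i\<in>unselected CARD('m) idx q. \<Sum>c\<in>UNIV. weight c * ((column c G \<bullet> u i)\<^sup>2 + (H $ c \<bullet> v i)\<^sup>2)) \<le> M \<bullet> M"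
proof -
  \<comment> \<open>The entries of \<open>M\<close> in the singular bases.\<close>
  define a where "a i j = u i \<bullet> (M *v v j)" for i j
  let ?m = "{1..CARD('m)}" and ?n = "{1..CARD('n)}" and ?I = "idx ` {1..q}"
  have I: "?I \<subseteq> ?m" using sel rm by (auto simp: is_selection_def)
  \<comment> \<open>For unselected \<open>j\<close>, including those above \<open>CARD('m)\<close>,
    \<open>S\<close> kills \<open>v j\<close> and only the \<open>H\<close> part of \<open>M\<close>
    remains.\<close>
  have Mv: "M *v v j = (\<Sum>c\<in>UNIV. (H $ c \<bullet> v j) *\<^sub>R w c)" if "j \<in> ?n - ?I" for j
  proof -
    have "S *v v j = 0" using s_orth[OF that] by (simp add: vec_eq_iff S_mult)
    then show ?thesis
      by (simp add: M_def matrix_vector_mult_add_rdistrib matrix_vector_mul_assoc[symmetric] W_mult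
          matrix_vector_mul_component)
  qed
  have cols: "(\<Sum>i\<in>?m. (a i j)\<^sup>2) = (\<Sum>c\<in>UNIV. weight c * (H $ c \<bullet> v j)\<^sup>2)" if "j \<in> ?n - ?I" for j
  proof -
    have "(\<Sum>i\<in>?m. (a i j)\<^sup>2) = (M *v v j) \<bullet> (M *v v j)"
      using orthonormal_basis_norm[OF ub] by (simp add: a_def inner_commute)
    also have "\<dots> = (\<Sum>c\<in>UNIV. weight c * (H $ c \<bullet> v j)\<^sup>2)"
      unfolding Mv[OF that] by (rule orthogonal_sum_inner_self[OF w_inner])
    finally show ?thesis .
  qed
  \<comment> \<open>Symmetrically, \<open>transpose W\<close> kills an unselected \<open>u i\<close>
    and only the \<open>G\<close> part remains.\<close>
  have Mu: "transpose M *v u i = (\<Sum>c\<in>UNIV. (column c G \<bullet> u i) *\<^sub>R s c)" if "i \<in> unselected CARD('m) idx q" for i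
  proof -
    have "transpose M = transpose H ** transpose W + transpose S ** transpose G"
      by (simp add: M_def matrix_transpose_mul[symmetric]) (simp add: transpose_def vec_eq_iff)
    moreover have "transpose W *v u i = 0" using w_orth[OF that] by (simp add: vec_eq_iff transpose_W_mult)
    moreover have "(transpose G *v u i) $ c = column c G \<bullet> u i" for c
      by (simp add: matrix_vector_mul_component transpose_def column_def)
    ultimately show ?thesis
      by (simp add: matrix_vector_mult_add_rdistrib matrix_vector_mul_assoc[symmetric] transpose_S_mult)
  qed
  have a_Mu: "a i j = (transpose M *v u i) \<bullet> v j" for i j
    by (simp add: a_def dot_lmul_matrix[symmetric] transpose_matrix_vector)
  have a0: "a i j = 0" if "i \<in> unselected CARD('m) idx q" "j \<in> ?n - ?I" for i j
    unfolding a_Mu Mu[OF that(1)] using s_orth[OF that(2)] by (simp add: inner_sum_left)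
  have rows: "(\<Sum>j\<in>?n. (a i j)\<^sup>2) = (\<Sum>c\<in>UNIV. weight c * (column c G \<bullet> u i)\<^sup>2)" if "i \<in> unselected CARD('m) idx q" for i
  proof -
    have "(\<Sum>j\<in>?n. (a i j)\<^sup>2) = (transpose M *v u i) \<bullet> (transpose M *v u i)"
      using orthonormal_basis_norm[OF vb] by (simp add: a_Mu)
    also have "\<dots> = (\<Sum>c\<in>UNIV. weight c * (column c G \<bullet> u i)\<^sup>2)"
      unfolding Mu[OF that] by (rule orthogonal_sum_inner_self[OF s_inner])
    finally show ?thesis .
  qed
  have nI: "?I \<subseteq> ?n" using I mn by auto
  have "M \<bullet> M = (\<Sum>j\<in>?n. (M *v v j) \<bullet> (M *v v j))" by (rule inner_matrix_orthonormal[OF vb])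
  also have "\<dots> = (\<Sum>j\<in>?n. \<Sum>i\<in>?m. (a i j)\<^sup>2)"
    using orthonormal_basis_norm[OF ub] by (simp add: a_def inner_commute)
  also have "\<dots> = (\<Sum>j\<in>?n - ?I. \<Sum>i\<in>?m. (a i j)\<^sup>2) + (\<Sum>j\<in>?I. \<Sum>i\<in>?m. (a i j)\<^sup>2)"
    by (rule sum.subset_diff[OF nI]) simp
  finally have split: "M \<bullet> M = (\<Sum>j\<in>?n - ?I. \<Sum>i\<in>?m. (a i j)\<^sup>2) + (\<Sum>j\<in>?I. \<Sum>i\<in>?m. (a i j)\<^sup>2)" .
  have "(\<Sum>i\<in>unselected CARD('m) idx q. \<Sum>c\<in>UNIV. weight c * (H $ c \<bullet> v i)\<^sup>2) = (\<Sum>j\<in>unselected CARD('m) idx q. \<Sum>i\<in>?m. (a i j)\<^sup>2)"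
    using mn by (intro sum.cong refl cols[symmetric]) auto
  also have "\<dots> \<le> (\<Sum>j\<in>?n - ?I. \<Sum>i\<in>?m. (a i j)\<^sup>2)"
    using mn by (intro sum_mono2) (auto intro: sum_nonneg)
  finally have h: "(\<Sum>i\<in>unselected CARD('m) idx q. \<Sum>c\<in>UNIV. weight c * (H $ c \<bullet> v i)\<^sup>2) \<le> (\<Sum>j\<in>?n - ?I. \<Sum>i\<in>?m. (a i j)\<^sup>2)" .
  have "(\<Sum>i\<in>unselected CARD('m) idx q. \<Sum>c\<in>UNIV. weight c * (column c G \<bullet> u i)\<^sup>2) = (\<Sum>i\<in>unselected CARD('m) idx q. \<Sum>j\<in>?n. (a i j)\<^sup>2)"
    by (intro sum.cong refl rows[symmetric])
  \<comment> \<open>By \<open>a0\<close> the mass of an unselected row sits in selected columns,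
    disjoint from the columns used for \<open>H\<close>.\<close>
  also have "\<dots> = (\<Sum>i\<in>unselected CARD('m) idx q. \<Sum>j\<in>?I. (a i j)\<^sup>2)"
    using nI a0 by (intro sum.cong refl sum.mono_neutral_right) auto
  also have "\<dots> = (\<Sum>j\<in>?I. \<Sum>i\<in>unselected CARD('m) idx q. (a i j)\<^sup>2)" by (rule sum.swap)
  also have "\<dots> \<le> (\<Sum>j\<in>?I. \<Sum>i\<in>?m. (a i j)\<^sup>2)"
    by (intro sum_mono sum_mono2) auto
  finally have g: "(\<Sum>i\<in>unselected CARD('m) idx q. \<Sum>c\<in>UNIV. weight c * (column c G \<bullet> u i)\<^sup>2) \<le> (\<Sum>j\<in>?I. \<Sum>i\<in>?m. (a i j)\<^sup>2)" .
  show ?thesis using split h g by (simp add: distrib_left sum.distrib)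
qed

text \<open>Expand each row of \<open>H\<close> in the basis \<open>v\<close>; \<open>E\<close>
  keeps the unselected components and turns \<open>v i\<close> into
  \<open>- \<sigma> i *\<^sub>R u i\<close>.\<close>

lemma error_term_eq:
  fixes G :: "real^'k^'m" and H :: "real^'n^'k"
  shows "(G ** H) \<bullet> E = - (\<Sum>i\<in>unselected CARD('m) idx q. \<Sum>c\<in>UNIV. \<sigma> i * (column c G \<bullet> u i) * (H $ c \<bullet> v i))"
proof -
  have Eh: "E *v h = - (\<Sum>i\<in>unselected CARD('m) idx q. (\<sigma> i * (h \<bullet> v i)) *\<^sub>R u i)" for h
  proof -
    have "E *v h = E *v (\<Sum>j = 1..CARD('n). (h \<bullet> v j) *\<^sub>R v j)"
      using orthonormal_basis_expand[OF vb, of h] by simp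
    also have "\<dots> = (\<Sum>j = 1..CARD('n). (h \<bullet> v j) *\<^sub>R (E *v v j))"
      by (simp add: linear_sum[OF matrix_vector_mul_linear] matrix_vector_mult_scaleR)
    also have "\<dots> = (\<Sum>j = 1..CARD('n). if j \<in> unselected CARD('m) idx q then - ((\<sigma> j * (h \<bullet> v j)) *\<^sub>R u j) else 0)"
      by (intro sum.cong refl) (auto simp: E_v mult.commute)
    also have "\<dots> = (\<Sum>j\<in>{1..CARD('n)} \<inter> unselected CARD('m) idx q. - ((\<sigma> j * (h \<bullet> v j)) *\<^sub>R u j))"
      by (subst sum.inter_restrict) auto
    also have "{1..CARD('n)} \<inter> unselected CARD('m) idx q = unselected CARD('m) idx q" using mn by auto
    finally show ?thesis by (simp add: sum_negf)
  qed
  have colH: "column c (transpose H) = H $ c" for c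
    by (simp add: column_def transpose_def vec_eq_iff)
  have "(G ** H) \<bullet> E = (\<Sum>c\<in>UNIV. column c G \<bullet> (E *v (H $ c)))"
    by (subst inner_matrix_mult_left, subst inner_matrix_columns) (simp add: column_matrix_mult colH)
  also have "\<dots> = - (\<Sum>c\<in>UNIV. \<Sum>i\<in>unselected CARD('m) idx q. \<sigma> i * (column c G \<bullet> u i) * (H $ c \<bullet> v i))"
    by (simp add: Eh inner_sum_right sum_negf mult_ac)
  also have "(\<Sum>c\<in>UNIV. \<Sum>i\<in>unselected CARD('m) idx q. \<sigma> i * (column c G \<bullet> u i) * (H $ c \<bullet> v i))
      = (\<Sum>i\<in>unselected CARD('m) idx q. \<Sum>c\<in>UNIV. \<sigma> i * (column c G \<bullet> u i) * (H $ c \<bullet> v i))"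
    by (rule sum.swap)
  finally show ?thesis .
qed

text \<open>The bound decouples into binary forms, one for each \<open>i\<close> and
  \<open>c\<close>, with diagonal entries \<open>weight c\<close> and off-diagonal entries
  \<open>- \<sigma> i\<close>; their smallest eigenvalue is
  \<open>weight c - \<sigma> i\<close>.\<close>

lemma hessian_form_ge:
  fixes G :: "real^'k^'m" and H :: "real^'n^'k"
  assumes "0 \<le> \<beta>" and \<beta>: "\<And>i c. i \<in> unselected CARD('m) idx q \<Longrightarrow> \<sigma> i - weight c \<le> \<beta>"
  shows "- \<beta> * ((G, H) \<bullet> (G, H)) \<le> (G, H) \<bullet> hessian (J X) (W, S) (G, H)"
proof -
  let ?g = "\<lambda>i c. column c G \<bullet> u i" and ?h = "\<lambda>i c. H $ c \<bullet> v i"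
  have "(\<Sum>i\<in>unselected CARD('m) idx q. \<Sum>c\<in>UNIV. (?g i c)\<^sup>2) = (\<Sum>c\<in>UNIV. \<Sum>i\<in>unselected CARD('m) idx q. (?g i c)\<^sup>2)" by (rule sum.swap)
  also have "\<dots> \<le> (\<Sum>c\<in>UNIV. \<Sum>i = 1..CARD('m). (?g i c)\<^sup>2)"
    by (intro sum_mono sum_mono2) auto
  also have "\<dots> = G \<bullet> G"
    using orthonormal_basis_norm[OF ub] by (simp add: inner_matrix_columns)
  finally have g: "(\<Sum>i\<in>unselected CARD('m) idx q. \<Sum>c\<in>UNIV. (?g i c)\<^sup>2) \<le> G \<bullet> G" .
  have "(\<Sum>i\<in>unselected CARD('m) idx q. \<Sum>c\<in>UNIV. (?h i c)\<^sup>2) = (\<Sum>c\<in>UNIV. \<Sum>i\<in>unselected CARD('m) idx q. (?h i c)\<^sup>2)" by (rule sum.swap)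
  also have "\<dots> \<le> (\<Sum>c\<in>UNIV. \<Sum>i = 1..CARD('n). (?h i c)\<^sup>2)"
    using mn by (intro sum_mono sum_mono2) auto
  also have "\<dots> = H \<bullet> H"
    using orthonormal_basis_norm[OF vb] by (simp add: inner_vec_def[of H])
  finally have h: "(\<Sum>i\<in>unselected CARD('m) idx q. \<Sum>c\<in>UNIV. (?h i c)\<^sup>2) \<le> H \<bullet> H" .
  \<comment> \<open>Since \<open>\<beta>\<close> is nonnegative, discarding the remaining components
    of \<open>G\<close> and \<open>H\<close> can only increase the left side.\<close>
  have "- \<beta> * ((G, H) \<bullet> (G, H)) \<le> - \<beta> * (\<Sum>i\<in>unselected CARD('m) idx q. \<Sum>c\<in>UNIV. (?g i c)\<^sup>2 + (?h i c)\<^sup>2)"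
    using g h \<open>0 \<le> \<beta>\<close> by (intro mult_left_mono_neg) (auto simp: sum.distrib)
  also have "\<dots> = (\<Sum>i\<in>unselected CARD('m) idx q. \<Sum>c\<in>UNIV. - \<beta> * ((?g i c)\<^sup>2 + (?h i c)\<^sup>2))"
    by (simp only: sum_distrib_left)
  also have "\<dots> \<le> (\<Sum>i\<in>unselected CARD('m) idx q. \<Sum>c\<in>UNIV.
      weight c * ((?g i c)\<^sup>2 + (?h i c)\<^sup>2) - 2 * (\<sigma> i * ?g i c * ?h i c))"
  proof (intro sum_mono)
    fix i c assume i: "i \<in> unselected CARD('m) idx q"
    have "0 \<le> \<sigma> i" using svd i by (auto simp: is_full_svd_def)
    \<comment> \<open>Completing the square: the right side equals \<open>(weight c + \<beta>) *
      (g\<^sup>2 + h\<^sup>2) - 2 * \<sigma> i * g * h\<close>.\<close>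
    then have "0 \<le> (weight c + \<beta> - \<sigma> i) * ((?g i c)\<^sup>2 + (?h i c)\<^sup>2) + \<sigma> i * (?g i c - ?h i c)\<^sup>2"
      using \<beta>[OF i, of c] by (intro add_nonneg_nonneg mult_nonneg_nonneg) auto
    then show "- \<beta> * ((?g i c)\<^sup>2 + (?h i c)\<^sup>2)
        \<le> weight c * ((?g i c)\<^sup>2 + (?h i c)\<^sup>2) - 2 * (\<sigma> i * ?g i c * ?h i c)"
      by (simp add: algebra_simps power2_eq_square)
  qed
  also have "\<dots> = (\<Sum>i\<in>unselected CARD('m) idx q. \<Sum>c\<in>UNIV. weight c * ((?g i c)\<^sup>2 + (?h i c)\<^sup>2)) + 2 * ((G ** H) \<bullet> E)"
    by (simp add: error_term_eq sum_subtractf sum_distrib_left)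
  also have "\<dots> \<le> (W ** H + G ** S) \<bullet> (W ** H + G ** S) + 2 * ((G ** H) \<bullet> E)"
    using cross_term_ge by simp
  also have "\<dots> = (G, H) \<bullet> hessian (J X) (W, S) (G, H)"
    by (simp add: hessian_J_form E_def)
  finally show ?thesis .
qed

text \<open>An eigenvector is \<open>(u\<^sub>i e\<^sub>c\<^sup>T, e\<^sub>c v\<^sub>i\<^sup>T)\<close>.\<close>

lemma hessian_eigenvalue:
  assumes i: "i \<in> unselected CARD('m) idx q"
  shows "is_eigenvalue (hessian (J X) (W, S)) (weight c - \<sigma> i)"
proof -
  define G :: "real^'k^'m" where "G = (\<chi> a d. if d = c then u i $ a else 0)"
  define H :: "real^'n^'k" where "H = (\<chi> d. if d = c then v i else 0)"
  have iN: "i \<in> {1..CARD('n)} - idx ` {1..q}" using i mn by auto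
  have colG: "column d G = (if d = c then u i else 0)" for d
    by (simp add: G_def column_def vec_eq_iff)
  have colH: "column d (transpose H) = (if d = c then v i else 0)" for d
    by (simp add: H_def column_def transpose_def vec_eq_iff)
  have G1: "G ** (S ** transpose S) = weight c *\<^sub>R G"
  proof -
    have "column d (G ** (S ** transpose S)) = column d (weight c *\<^sub>R G)" for d
    proof -
      have "column d (G ** (S ** transpose S)) = weight d *\<^sub>R column d G"
        by (simp add: column_matrix_mult SS[unfolded column_matrix_mult] matrix_vector_mult_scaleR
            matrix_vector_mult_basis)
      then show ?thesis by (simp add: colG) (simp add: column_def G_def vec_eq_iff)
    qed
    then show ?thesis by (simp add: matrix_eq_columns)
  qed
  \<comment> \<open>The mixed Hessian terms vanish, here since \<open>v i\<close> is orthogonal to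
    the rows of \<open>S\<close>, and in \<open>WG\<close> since \<open>u i\<close> is orthogonal to
    the columns of \<open>W\<close>.\<close>
  have HS: "H ** transpose S = 0"
  proof -
    have "H *v s d = 0" for d
      using s_orth[OF iN, of d]
      by (simp add: vec_eq_iff matrix_vector_mul_component H_def inner_commute)
    then show ?thesis
      by (simp add: matrix_eq_columns column_matrix_mult column_transpose_S)
         (simp add: column_def vec_eq_iff)
  qed
  \<comment> \<open>The error exchanges the two halves of the eigenvector, which yields the shift by
    \<open>- \<sigma> i\<close>.\<close>
  have EH: "E ** transpose H = - \<sigma> i *\<^sub>R G"
  proof -
    have "column d (E ** transpose H) = column d (- \<sigma> i *\<^sub>R G)" for d
      using i iN by (simp add: column_matrix_mult colH E_v) (simp add: column_def G_def vec_eq_iff)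
    then show ?thesis by (simp add: matrix_eq_columns)
  qed
  have H1: "transpose W ** W ** H = weight c *\<^sub>R H"
  proof -
    have "transpose (transpose W ** W ** H) = transpose H ** (transpose W ** W)"
      by (simp add: matrix_transpose_mul)
    also have "\<dots> = transpose (weight c *\<^sub>R H)"
    proof -
      have "column d (transpose H ** (transpose W ** W)) = column d (transpose (weight c *\<^sub>R H))" for d
      proof -
        have "column d (transpose H ** (transpose W ** W)) = weight d *\<^sub>R column d (transpose H)"
          by (simp add: column_matrix_mult WW[unfolded column_matrix_mult] matrix_vector_mult_scaleR
              matrix_vector_mult_basis)
        then show ?thesis
          by (simp add: colH) (simp add: column_def H_def transpose_def vec_eq_iff)
      qed
      then show ?thesis by (simp add: matrix_eq_columns)
    qed
    finally show ?thesis by (metis transpose_transpose)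
  qed
  have WG: "transpose W ** G = 0"
  proof -
    have "transpose W *v u i = 0" using w_orth[OF i] by (simp add: vec_eq_iff transpose_W_mult)
    then show ?thesis
      by (simp add: matrix_eq_columns column_matrix_mult colG) (simp add: column_def vec_eq_iff)
  qed
  have GE: "transpose G ** E = - \<sigma> i *\<^sub>R H"
  proof -
    have "transpose (transpose G ** E) = transpose E ** G"
      by (simp add: matrix_transpose_mul)
    also have "\<dots> = transpose (- \<sigma> i *\<^sub>R H)"
    proof -
      have "column d (transpose E ** G) = column d (transpose (- \<sigma> i *\<^sub>R H))" for d
        using E_u_unselected[OF i]
        by (simp add: column_matrix_mult colG) (simp add: column_def H_def transpose_def vec_eq_iff)
      then show ?thesis by (simp add: matrix_eq_columns)
    qed
    finally show ?thesis by (metis transpose_transpose)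
  qed
  have "hessian (J X) (W, S) (G, H) = (weight c - \<sigma> i) *\<^sub>R (G, H)"
    unfolding hessian_J E_def[symmetric]
    using G1 HS EH H1 WG GE
    by (simp add: matrix_mul_assoc[symmetric] scaleR_diff_left)
  moreover have "(G, H) \<noteq> 0"
  proof
    assume "(G, H) = 0"
    then have "u i = 0" using colG[of c] by (simp add: zero_prod_def column_def vec_eq_iff)
    then show False using u_inner[of i i] i by auto
  qed
  ultimately show ?thesis unfolding is_eigenvalue_def by blast
qed

text \<open>Reduces the eigenvalue claims to maximizing \<open>\<sigma> i - weight c\<close> over
  unselected \<open>i\<close> and all columns \<open>c\<close>.\<close>

lemma lambda_min_hessian:
  assumes "0 \<le> \<beta>" and "\<And>i c. i \<in> unselected CARD('m) idx q \<Longrightarrow> \<sigma> i - weight c \<le> \<beta>"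
    and "i \<in> unselected CARD('m) idx q" and "\<sigma> i - weight c = \<beta>"
  shows "lambda_min (hessian (J X) (W, S)) = - \<beta>"
proof (rule lambda_min_eqI)
  show "is_eigenvalue (hessian (J X) (W, S)) (- \<beta>)"
    using hessian_eigenvalue[OF assms(3), of c] assms(4) by (metis minus_diff_eq)
  fix x :: "(real^'k^'m) \<times> (real^'n^'k)"
  show "- \<beta> * (x \<bullet> x) \<le> x \<bullet> hessian (J X) (W, S) x"
    using hessian_form_ge[OF assms(1,2)] by (cases x) blast
qed

end

section \<open>Global minimality and smallest Hessian eigenvalues\<close>

theorem theorem4p3:
  fixes X :: "real^'n^'m"
    and col :: "'k::finite \<Rightarrow> nat"
    and \<sigma> lam :: "nat \<Rightarrow> real"
    and r q :: nat
    and W0 :: "real^'k^'m" and S0 :: "real^'n^'k"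
  assumes "CARD('m) < CARD('n)"
    and "bij_betw col UNIV {1..CARD('k)}"
    and "rank X = r"
    and "\<forall>i\<in>{1..CARD('m)}. \<forall>j\<in>{1..CARD('m)}. i \<le> j \<longrightarrow> \<sigma> j \<le> \<sigma> i"
    and "\<forall>i\<in>{1..r}. \<sigma> i > 0"
    and "\<forall>i\<in>{r<..CARD('m)}. \<sigma> i = 0"
    and "1 \<le> q" and "q \<le> min CARD('k) r"
    and "is_balanced_canonical_point col X \<sigma> r q lam (W0, S0)"
  shows "gradient (J X) (W0, S0) = 0 \<and> (W0, S0) \<in> M0 \<and>
    (q = min CARD('k) r \<and> is_maximal \<sigma> q lam \<longrightarrow>
       (\<forall>(W :: real^'k^'m) (S :: real^'n^'k). J X (W0, S0) \<le> J X (W, S))) \<and>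
    (q = min CARD('k) r \<and> \<not> is_maximal \<sigma> q lam \<longrightarrow>
       lambda_min (hessian (J X) (W0, S0)) = - (\<sigma> (first_gap \<sigma> q lam) - lam CARD('k))) \<and>
    (q < min CARD('k) r \<longrightarrow>
       (is_maximal \<sigma> q lam \<longrightarrow>
          lambda_min (hessian (J X) (W0, S0)) = - \<sigma> (q + 1)) \<and>
       (\<not> is_maximal \<sigma> q lam \<longrightarrow>
          lambda_min (hessian (J X) (W0, S0)) = - \<sigma> (first_gap \<sigma> q lam)))"
proof -
  obtain u v idx where svd: "is_full_svd X \<sigma> u v" and sel: "is_selection \<sigma> r q idx lam"
    and P: "(W0, S0) = canonical_point col u v q idx lam"
    using assms(9) by (auto simp: is_balanced_canonical_point_def)
  have rm: "r \<le> CARD('m)" using rank_bound[of X] assms(3) by simp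
  interpret svd_selection X \<sigma> lam u v idx r q col
    using svd sel assms rm by unfold_locales auto
  have WS: "W0 = W" "S0 = S" using P canonical_point_eq by auto
  have anti: "\<sigma> j \<le> \<sigma> i" if "1 \<le> i" "i \<le> j" "j \<le> CARD('m)" for i j
    using svd_antimono[OF svd that] .
  have sig0: "0 \<le> \<sigma> i" if "i \<in> {1..CARD('m)}" for i
    using svd that by (auto simp: is_full_svd_def)
  have sel_img: "idx ` {1..q} \<subseteq> {1..r}" "inj_on idx {1..q}"
    using sel by (auto simp: is_selection_def)

  have min_a: "J X (W, S) \<le> J X (W', S')"
    if q: "q = min CARD('k) r" and max: "is_maximal \<sigma> q lam" for W' :: "real^'k^'m" and S' :: "real^'n^'k"
  \<comment> \<open>If \<open>q = r\<close>, all positive singular values are selected and the error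
    is zero. Otherwise \<open>q = CARD('k)\<close> and the low-rank bound is attained.\<close>
  proof (cases "q = r")
    case True
    then have "idx ` {1..q} = {1..r}"
      using sel_img by (intro card_subset_eq) (auto simp: card_image)
    then have "(\<Sum>i\<in>unselected CARD('m) idx q. (\<sigma> i)\<^sup>2) = 0" using assms(6) by (intro sum.neutral) auto
    then show ?thesis by (simp only: J_eq) (simp add: J_def)
  next
    case False
    then have qk: "q = CARD('k)" using q by linarith
    have "(\<Sum>i\<in>idx ` {1..q}. (\<sigma> i)\<^sup>2) = (\<Sum>j = 1..q. (\<sigma> (idx j))\<^sup>2)"
      by (rule sum.reindex_cong[OF sel_img(2)]) auto
    also have "\<dots> = (\<Sum>j = 1..q. (\<sigma> j)\<^sup>2)"
      using sel max by (intro sum.cong refl) (auto simp: is_selection_def is_maximal_def)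
    finally have "(\<Sum>i\<in>unselected CARD('m) idx q. (\<sigma> i)\<^sup>2) = (\<Sum>i = 1..CARD('m). (\<sigma> i)\<^sup>2) - (\<Sum>i = 1..CARD('k). (\<sigma> i)\<^sup>2)"
      using sel_img rm qk by (subst sum_diff) auto
    also have "\<dots> \<le> (norm (X - W' ** S'))\<^sup>2"
      using qk assms(8) rm by (intro low_rank_error_ge[OF svd assms(1)]) auto
    finally show ?thesis by (simp add: J_eq) (simp add: J_def)
  qed

  define p where "p = first_gap \<sigma> q lam"
  have gap: "p \<in> {1..q}" "lam p < \<sigma> p" "\<forall>i\<in>unselected CARD('m) idx q. \<sigma> i \<le> \<sigma> p" "\<exists>i\<in>unselected CARD('m) idx q. \<sigma> i = \<sigma> p"
    if nmax: "\<not> is_maximal \<sigma> q lam"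
  proof -
    have le: "lam j \<le> \<sigma> j" if "j \<in> {1..q}" for j
      by (rule sorted_selection_le[OF sel rm that anti])
    obtain j where "j \<in> {1..q}" "lam j \<noteq> \<sigma> j" using nmax by (auto simp: is_maximal_def)
    with le[of j] have "j \<in> {1..q} \<and> lam j < \<sigma> j" by auto
    then have p: "p \<in> {1..q} \<and> lam p < \<sigma> p"
      unfolding p_def first_gap_def by (rule LeastI)
    then show p1: "p \<in> {1..q}" and p2: "lam p < \<sigma> p" by auto
    \<comment> \<open>Minimality of the gap excludes strict inequality before \<open>p\<close>, and
      \<open>le\<close> excludes the opposite one.\<close>
    have below: "lam j = \<sigma> j" if "1 \<le> j" "j < p" for j
      using not_less_Least[of j "\<lambda>p. p \<in> {1..q} \<and> lam p < \<sigma> p"] that p1 le[of j]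
      unfolding p_def first_gap_def by fastforce
    have above: "lam j < \<sigma> p" if "p \<le> j" "j \<le> q" for j
    proof -
      have "lam j \<le> lam p" using sel that p1 by (auto simp: is_selection_def)
      then show ?thesis using p2 by simp
    qed
    have "p \<le> CARD('m)" using p1 assms(8) rm by auto
    then show "\<forall>i\<in>unselected CARD('m) idx q. \<sigma> i \<le> \<sigma> p" "\<exists>i\<in>unselected CARD('m) idx q. \<sigma> i = \<sigma> p"
      using largest_unselected[OF sel rm _ _ _ anti below above] p1 by auto
  qed

  have min_b: "lambda_min (hessian (J X) (W, S)) = - (\<sigma> p - lam CARD('k))"
    if q: "q = min CARD('k) r" and nmax: "\<not> is_maximal \<sigma> q lam"
  proof -
    note g = gap[OF nmax]
    obtain i where i: "i \<in> unselected CARD('m) idx q" "\<sigma> i = \<sigma> p" using g(4) by auto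
    \<comment> \<open>If \<open>q = r\<close>, an unselected \<open>i\<close> lies above the rank
      and has \<open>\<sigma> i = 0\<close>, yet \<open>\<sigma> i = \<sigma> p\<close> exceeds
      \<open>lam p > 0\<close>.\<close>
    have "q \<noteq> r"
    proof
      assume "q = r"
      then have "idx ` {1..q} = {1..r}"
        using sel_img by (intro card_subset_eq) (auto simp: card_image)
      then have "\<sigma> i = 0" using i assms(6) by auto
      moreover have "0 < lam p" using sel g(1) unfolding is_selection_def by blast
      ultimately show False using i g(2) by simp
    qed
    then have qk: "q = CARD('k)" using q by linarith
    have colq: "col c \<le> q" for c using bij_betwE[OF assms(2)] qk by auto
    \<comment> \<open>All columns are used, so no weight is zero and the smallest,
      \<open>lam q\<close>, belongs to column number \<open>q\<close>.\<close>
    have wge: "lam q \<le> weight c" for c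
      using sel colq[of c] col_pos[of c] by (auto simp: weight_def is_selection_def)
    obtain c where c: "col c = q" using col_surj[of q] assms(7) qk by auto
    have "lam q \<le> lam p" using sel g(1) by (auto simp: is_selection_def)
    have "lambda_min (hessian (J X) (W, S)) = - (\<sigma> p - lam q)"
    proof (rule lambda_min_hessian[OF _ _ i(1)])
      show "0 \<le> \<sigma> p - lam q" using \<open>lam q \<le> lam p\<close> g(2) by simp
      show "\<sigma> j - weight d \<le> \<sigma> p - lam q" if "j \<in> unselected CARD('m) idx q" for j d
        using g(3) that wge[of d] by (intro diff_mono) blast+
      show "\<sigma> i - weight c = \<sigma> p - lam q" using c i by (simp add: weight_def)
    qed
    then show ?thesis by (simp add: qk)
  qed

  have min_c: "lambda_min (hessian (J X) (W, S)) = - \<sigma> t"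
    if q: "q < min CARD('k) r" and t: "\<forall>i\<in>unselected CARD('m) idx q. \<sigma> i \<le> \<sigma> t" "\<exists>i\<in>unselected CARD('m) idx q. \<sigma> i = \<sigma> t" for t
  proof -
    obtain i where i: "i \<in> unselected CARD('m) idx q" "\<sigma> i = \<sigma> t" using t by auto
    obtain c where c: "col c = q + 1" using col_surj[of "q + 1"] q by auto
    show ?thesis
    proof (rule lambda_min_hessian[OF _ _ i(1)])
      show "0 \<le> \<sigma> t" using sig0[of i] i by auto
      show "\<sigma> j - weight d \<le> \<sigma> t" if "j \<in> unselected CARD('m) idx q" for j d
        using bspec[OF t(1) that] weight_nonneg[of d] by linarith
      show "\<sigma> i - weight c = \<sigma> t" using c i by (simp add: weight_def)
    qed
  qed

  \<comment> \<open>At a maximal point \<open>t = q + 1\<close>: it is at most \<open>r\<close>, and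
    no selection is left for the premise \<open>above\<close>.\<close>
  have max_c: "\<forall>i\<in>unselected CARD('m) idx q. \<sigma> i \<le> \<sigma> (q + 1)" "\<exists>i\<in>unselected CARD('m) idx q. \<sigma> i = \<sigma> (q + 1)"
    if "q < min CARD('k) r" "is_maximal \<sigma> q lam"
    using that rm
    by (intro largest_unselected[OF sel rm _ _ _ anti]; auto simp: is_maximal_def)+

  show ?thesis
    unfolding WS p_def[symmetric]
    using gradient_zero balanced min_a min_b min_c[OF _ gap(3,4)] min_c[OF _ max_c] by blast
qed

end
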